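(* Let $$G=\{z\in\mathbb C^3:0>2\operatorname{Re} z_3+(\operatorname{Im} z_3)^2+|z_1|^2-|z_2|^2\},$$ and let $D\subset\mathbb C^3$ be an open set such that $0\in\partial D$ and $D\supset G\cap\mathbb D_\varepsilon^3$ for some $\varepsilon>0$, where $\mathbb D_\varepsilon=\{\lambda\in\mathbb C:|\lambda|<\varepsilon\}$. If $S(D)\neq\mathbb C^3$, then there exists a complex line $l\subset\mathbb C^2\times\{0\}\subset\mathbb C^3$ through $0$ such that $(\mathbb C^2\times\{0\})\setminus l\subset D$ near $0$, $l\subset\partial D$ near $0$, and $S(D)\supset\mathbb C^3\setminus l$.
   Context: A two-dimensional plane in $\mathbb C^n$ is a complex affine subspace of complex dimension $2$. For such a plane $P$, $D\cap P$ is regarded as an open subset of $P\cong\mathbb C^2$; the empty set is regarded as pseudoconvex. For an open set $D\subset\mathbb C^n$, $S(D)$ denotes the set of all $a\in\mathbb C^n$ for which there is a two-dimensional plane $P\ni a$ such that $P\cap D$ is non-pseudoconvex. "$A\subset B$ near $0$" means that $A\cap U\subset B$ for some neighborhood $U$ of $0$. *)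

theory Defs
  imports "HOL-Analysis.Analysis"
begin

text \<open>
  Complex \<open>n\<close>-space is the type \<open>complex ^ 'n\<close>; \<open>(*s)\<close> is multiplication by complex scalars,
  and \<open>vec.subspace\<close>, \<open>vec.dim\<close> refer to the complex vector space structure.

  Only continuous real-valued (pluri)subharmonic functions are needed, since pseudoconvexity
  is defined by the existence of a continuous plurisubharmonic exhaustion function.
  For continuous functions the integrand below is continuous, so the integral is the usual
  circular mean.
\<close>

definition cont_subharmonic_on :: "complex set \<Rightarrow> (complex \<Rightarrow> real) \<Rightarrow> bool" where
  "cont_subharmonic_on V v \<longleftrightarrow> continuous_on V v \<and>
     (\<forall>c r. 0 < r \<and> cball c r \<subseteq> V \<longrightarrow>
        v c \<le> integral {0..2 * pi} (\<lambda>t. v (c + of_real r * cis t)) / (2 * pi))"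

definition cont_psh_on :: "(complex ^ 'n) set \<Rightarrow> (complex ^ 'n \<Rightarrow> real) \<Rightarrow> bool" where
  "cont_psh_on \<Omega> u \<longleftrightarrow> continuous_on \<Omega> u \<and>
     (\<forall>z w. cont_subharmonic_on {\<tau>. z + \<tau> *s w \<in> \<Omega>} (\<lambda>\<tau>. u (z + \<tau> *s w)))"

text \<open>Neither connectedness nor nonemptiness is required; the empty set and the whole space
  are pseudoconvex.\<close>

definition pseudoconvex :: "(complex ^ 'n) set \<Rightarrow> bool" where
  "pseudoconvex \<Omega> \<longleftrightarrow> open \<Omega> \<and>
     (\<exists>u. cont_psh_on \<Omega> u \<and> (\<forall>c. compact {z \<in> \<Omega>. u z \<le> c}))"

definition complex_plane :: "(complex ^ 'n) set \<Rightarrow> bool" where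
  "complex_plane P \<longleftrightarrow> (\<exists>p V. vec.subspace V \<and> vec.dim V = 2 \<and> P = (\<lambda>x. p + x) ` V)"

definition plane_coords :: "(complex ^ 2 \<Rightarrow> complex ^ 'n) \<Rightarrow> (complex ^ 'n) set \<Rightarrow> bool" where
  "plane_coords f P \<longleftrightarrow> (\<exists>p A. f = (\<lambda>z. p + A *v z)) \<and> bij_betw f UNIV P"

text \<open>Pseudoconvexity of a subset \<open>E\<close> of a plane \<open>P\<close>, with \<open>P\<close> identified with complex 2-space.
  Any two affine coordinates on \<open>P\<close> differ by an affine automorphism of complex 2-space, so
  the quantification over all of them amounts to fixing any one.\<close>

definition pseudoconvex_in_plane :: "(complex ^ 'n) set \<Rightarrow> (complex ^ 'n) set \<Rightarrow> bool" where
  "pseudoconvex_in_plane P E \<longleftrightarrow> (\<forall>f. plane_coords f P \<longrightarrow> pseudoconvex (f -` E))"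

definition S :: "(complex ^ 'n) set \<Rightarrow> (complex ^ 'n) set" where
  "S D = {a. \<exists>P. complex_plane P \<and> a \<in> P \<and> \<not> pseudoconvex_in_plane P (P \<inter> D)}"

definition subset_near_0 :: "(complex ^ 'n) set \<Rightarrow> (complex ^ 'n) set \<Rightarrow> bool" where
  "subset_near_0 A B \<longleftrightarrow> (\<exists>U. open U \<and> 0 \<in> U \<and> A \<inter> U \<subseteq> B)"

definition G :: "(complex ^ 3) set" where
  "G = {z. 0 > 2 * Re (z $ 3) + (Im (z $ 3))\<^sup>2 + (cmod (z $ 1))\<^sup>2 - (cmod (z $ 2))\<^sup>2}"

definition polydisc :: "real \<Rightarrow> (complex ^ 'n) set" where
  "polydisc \<epsilon> = {z. \<forall>i. cmod (z $ i) < \<epsilon>}"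

end

theory Submission
  imports Defs
begin

text \<open>
  Let \<open>a \<notin> S D\<close>. In every plane through \<open>a\<close> the continuity principle applies: parallel discs whose
  boundaries stay in \<open>D\<close> and one of which lies in \<open>D\<close> all lie in \<open>D\<close>. Discs in directions close to
  \<open>(0, 1, 0)\<close>, with centres near the origin, have their boundaries in \<open>G\<close>. If such discs can be moved
  within a plane through \<open>a\<close> from a position inside \<open>G\<close> to a position containing \<open>0\<close>, this
  contradicts \<open>0 \<notin> D\<close>; hence \<open>a = (a1, a2, 0)\<close> with \<open>a1 \<noteq> 0\<close>, and \<open>l\<close> is the line through \<open>0\<close> and \<open>a\<close>.
  For \<open>q\<close> in \<open>{z3 = 0}\<close> near \<open>0\<close> but off \<open>l\<close>, moving suitably tilted discs along the line from \<open>a\<close>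
  to \<open>q\<close> shows \<open>q \<in> D\<close>. A point of \<open>l\<close> near \<open>0\<close> that belonged to \<open>D\<close> would then give a whole disc
  in \<open>{z3 = 0} \<inter> D\<close> that can be moved to \<open>0\<close>. Finally a point outside \<open>S D\<close> and off \<open>l\<close> would produce
  a second such line, which is impossible since \<open>{z3 = 0} - l\<close> lies in \<open>D\<close> near \<open>0\<close>.
\<close>

section \<open>The continuity principle\<close>

text \<open>Maximum principle without a connectedness argument: around a maximum point
  \<open>x\<close> the largest circle inside the closed disc touches the boundary circle, and the
  mean value inequality forces \<open>v = v x\<close> on all of it.\<close>

lemma cont_subharmonic_on_max:
  assumes sh: "cont_subharmonic_on V v" and sub: "cball c \<rho> \<subseteq> V"
    and bd: "\<And>\<tau>. \<tau> \<in> sphere c \<rho> \<Longrightarrow> v \<tau> \<le> M" and "\<sigma> \<in> cball c \<rho>"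
  shows "v \<sigma> \<le> M"
proof -
  have cont: "continuous_on (cball c \<rho>) v"
    using sh sub continuous_on_subset unfolding cont_subharmonic_on_def by blast
  obtain x where x: "x \<in> cball c \<rho>" and mx: "\<And>y. y \<in> cball c \<rho> \<Longrightarrow> v y \<le> v x"
    using continuous_attains_sup[OF compact_cball _ cont] assms(4) by blast
  define r where "r = \<rho> - dist c x"
  show ?thesis
  proof (cases "r = 0")
    case True
    then show ?thesis using bd[of x] mx[OF assms(4)] by (simp add: r_def)
  next
    case False
    then have r: "r > 0" using x by (simp add: r_def)
    have sub': "cball x r \<subseteq> cball c \<rho>"
      unfolding r_def by (auto, metis (no_types, lifting) add.commute dist_commute dist_triangle_le le_diff_eq)
    have circ: "x + of_real r * cis t \<in> cball c \<rho>" for t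
      using sub' r by (force simp: dist_norm norm_mult)
    have contc: "continuous_on {0..2*pi} (\<lambda>t. v (x + of_real r * cis t))"
      by (rule continuous_on_compose2[OF cont]) (use circ in \<open>auto intro!: continuous_intros simp: cis_conv_exp\<close>)
    let ?g = "\<lambda>t. v x - v (x + of_real r * cis t)"
    have "v x \<le> integral {0..2 * pi} (\<lambda>t. v (x + of_real r * cis t)) / (2 * pi)"
      using sh r sub' sub unfolding cont_subharmonic_on_def by blast
    then have "integral {0..2*pi} ?g \<le> 0"
      using contc by (subst integral_diff) (auto simp: field_simps intro: integrable_continuous_real)
    moreover have "integral {0..2*pi} ?g \<ge> 0"
      using contc mx circ by (intro integral_nonneg) (auto intro!: integrable_continuous_real continuous_intros)
    ultimately have z: "integral {0..2*pi} ?g = 0" by simp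
    have "continuous_on {0..2*pi} ?g" by (intro continuous_intros contc)
    then have eq: "?g t = 0" if "t \<in> {0..2*pi}" for t
      using integral_eq_0_iff[of 0 "2*pi" ?g] z mx circ that by auto
    \<comment> \<open>The radial direction from \<open>c\<close> through \<open>x\<close>, in which
      the circle of radius \<open>r\<close> about \<open>x\<close> meets
      \<open>sphere c \<rho>\<close>. For \<open>x = c\<close> the two circles coincide and any unit
      number serves.\<close>
    define y where "y = (if x = c then 1 else (x - c) / of_real (cmod (x - c)))"
    have "cmod y = 1" by (simp add: y_def norm_divide)
    then obtain t where t: "t \<in> {0..2*pi}" "y = cis t"
      by (metis complex_unimodular_polar cis.ctr atLeastAtMost_iff less_imp_le)
    have "x + of_real r * y \<in> sphere c \<rho>"
    proof (cases "x = c")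
      case True
      then show ?thesis using r by (simp add: y_def r_def dist_norm)
    next
      case False
      have "x + of_real r * y - c = (1 + of_real (r / cmod (x-c))) * (x - c)"
        using False by (simp add: y_def field_simps)
      also have "1 + of_real (r / cmod (x-c)) = (of_real (1 + r / cmod (x-c)) :: complex)" by simp
      finally have "cmod (x + of_real r * y - c) = (1 + r / cmod (x-c)) * cmod (x - c)"
        using r by (simp only: norm_mult norm_of_real) (simp add: abs_of_nonneg)
      also have "\<dots> = \<rho>" using False by (simp add: r_def field_simps dist_norm norm_minus_commute)
      finally show ?thesis by (simp add: dist_norm norm_minus_commute)
    qed
    from bd[OF this] have "v x \<le> M" using eq[OF t(1)] t(2) by simp
    then show ?thesis using mx[OF assms(4)] by simp
  qed
qed

lemma continuous_on_vector_scalar_mult [continuous_intros]: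
  fixes f :: "'b::topological_space \<Rightarrow> complex" and g :: "'b \<Rightarrow> complex ^ 'n"
  assumes "continuous_on A f" "continuous_on A g"
  shows "continuous_on A (\<lambda>x. f x *s g x)"
  unfolding vector_scalar_mult_def
  by (intro continuous_on_vec_lambda continuous_intros assms)

text \<open>The exhaustion function is bounded by some \<open>M\<close> on the compact union of the
  boundary circles. By the maximum principle every disc of the family inside \<open>\<Omega>\<close>
  lies in the compact set where \<open>u\<close> is at most \<open>M\<close>, so the discs cannot
  leave \<open>\<Omega>\<close> as \<open>t\<close> runs from 1 down to 0.\<close>

lemma pseudoconvex_disc_family:
  fixes \<Omega> :: "(complex ^ 'n) set"
  assumes psc: "pseudoconvex \<Omega>"
    and bd: "\<And>t \<tau>. 0 \<le> t \<Longrightarrow> t \<le> 1 \<Longrightarrow> cmod \<tau> = \<rho> \<Longrightarrow> c + of_real t *s d + \<tau> *s w \<in> \<Omega>"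
    and init: "\<And>\<tau>. cmod \<tau> \<le> \<rho> \<Longrightarrow> c + d + \<tau> *s w \<in> \<Omega>"
    and "cmod \<sigma> \<le> \<rho>"
  shows "c + \<sigma> *s w \<in> \<Omega>"
proof -
  define h where "h = (\<lambda>(t::real, \<tau>). c + of_real t *s d + \<tau> *s w)"
  have conth: "continuous_on UNIV h"
    unfolding h_def case_prod_beta by (intro continuous_intros)
  obtain u where opn: "open \<Omega>" and psh: "cont_psh_on \<Omega> u"
    and exh: "\<And>c. compact {z \<in> \<Omega>. u z \<le> c}"
    using psc unfolding pseudoconvex_def by blast
  have contu: "continuous_on \<Omega> u" using psh unfolding cont_psh_on_def by blast
  have "compact ((u \<circ> h) ` ({0..1} \<times> sphere 0 \<rho>))"
  proof (intro compact_continuous_image continuous_on_compose)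
    show "continuous_on ({0..1} \<times> sphere 0 \<rho>) h"
      using conth continuous_on_subset by blast
    show "continuous_on (h ` ({0..1} \<times> sphere 0 \<rho>)) u"
      by (rule continuous_on_subset[OF contu]) (auto simp: h_def intro: bd)
  qed (auto intro: compact_Times)
  then obtain M where M: "\<And>t \<tau>. t \<in> {0..1} \<Longrightarrow> cmod \<tau> = \<rho> \<Longrightarrow> u (h (t, \<tau>)) \<le> M"
    using bounded_imp_bdd_above[OF compact_imp_bounded] unfolding bdd_above_def by fastforce
  define K where "K = {z \<in> \<Omega>. u z \<le> M}"
  have closedK: "closed K" unfolding K_def by (rule compact_imp_closed[OF exh])
  define T where "T = {t \<in> {0..1}. \<forall>\<tau> \<in> cball 0 \<rho>. h (t, \<tau>) \<in> \<Omega>}"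
  \<comment> \<open>Replacing the open set \<open>\<Omega>\<close> by the closed set
    \<open>K\<close> is the gain from the maximum principle: it makes \<open>T\<close>
    closed.\<close>
  have T_eq: "T = {0..1} \<inter> (\<Inter>\<tau>\<in>cball 0 \<rho>. (\<lambda>t. h (t, \<tau>)) -` K)"
  proof (intro equalityI subsetI)
    fix t assume t: "t \<in> T"
    have "u (h (t, \<tau>)) \<le> M" if "\<tau> \<in> cball 0 \<rho>" for \<tau>
    proof (rule cont_subharmonic_on_max[where c = 0 and \<rho> = \<rho> and v = "\<lambda>\<tau>. u (h (t, \<tau>))"])
      show "cont_subharmonic_on {\<tau>. h (t, \<tau>) \<in> \<Omega>} (\<lambda>\<tau>. u (h (t, \<tau>)))"
        using psh unfolding cont_psh_on_def h_def by simp
    qed (use t that M in \<open>auto simp: T_def\<close>)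
    then show "t \<in> {0..1} \<inter> (\<Inter>\<tau>\<in>cball 0 \<rho>. (\<lambda>t. h (t, \<tau>)) -` K)"
      using t by (auto simp: T_def K_def)
  qed (auto simp: T_def K_def)
  have "continuous_on UNIV (\<lambda>t. h (t, \<tau>))" for \<tau>
    by (rule continuous_on_compose2[OF conth]) (auto intro!: continuous_intros)
  then have closedT: "closed T"
    unfolding T_eq using closedK by (auto intro!: closed_Int closed_INT closed_vimage)
  \<comment> \<open>The parameters of discs that leave \<open>\<Omega>\<close>, a projection of a
    compact set. Two disjoint closed sets \<open>T\<close> and \<open>T'\<close> cover the connected
    interval, so one of them is empty.\<close>
  define T' where "T' = fst ` (({0..1} \<times> cball 0 \<rho>) \<inter> h -` (- \<Omega>))"
  have "compact T'" unfolding T'_def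
    using opn conth
    by (intro compact_continuous_image compact_Int_closed compact_Times closed_vimage continuous_intros) auto
  then have closedT': "closed T'" by (rule compact_imp_closed)
  have "{0..1} \<subseteq> T \<union> T'" "T \<inter> T' \<inter> {0..1} = {}"
    unfolding T_def T'_def by (force, fastforce)
  moreover have "1 \<in> T" using init by (simp add: T_def h_def)
  ultimately have "T' \<inter> {0..1} = {}"
    using connected_closedD[OF connected_Icc[of 0 "1::real"] _ _ closedT closedT'] by auto
  then have "0 \<in> T" using \<open>{0..1} \<subseteq> T \<union> T'\<close> by fastforce
  then show ?thesis using assms(4) by (auto simp: T_def h_def)
qed

section \<open>Slices through a point outside \<open>S D\<close>\<close>

text \<open>The map is an affine coordinate system on the plane through \<open>p\<close> spanned by
  \<open>v\<close> and \<open>w\<close>. This plane contains \<open>a\<close>, so its slice of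
  \<open>D\<close> is pseudoconvex.\<close>

lemma pseudoconvex_slice:
  fixes D :: "(complex ^ 'n) set"
  assumes "a \<notin> S D" and a: "a = p + \<alpha> *s v + \<beta> *s w"
    and indep: "\<And>x y. x *s v + y *s w = 0 \<Longrightarrow> x = 0 \<and> y = 0"
  shows "pseudoconvex ((\<lambda>z :: complex ^ 2. p + z $ 1 *s v + z $ 2 *s w) -` D)"
proof -
  let ?f = "\<lambda>z :: complex ^ 2. p + z $ 1 *s v + z $ 2 *s w"
  let ?A = "(\<chi> i j. if j = 1 then v $ i else w $ i) :: complex ^ 2 ^ 'n"
  have f: "?f = (\<lambda>z. p + ?A *v z)"
    by (auto simp: fun_eq_iff vec_eq_iff matrix_vector_mult_def sum_2 algebra_simps)
  have inj: "inj ?f"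
  proof (rule injI)
    fix x y assume "?f x = ?f y"
    then have "(x $ 1 - y $ 1) *s v + (x $ 2 - y $ 2) *s w = 0"
      by (simp add: vec.scale_left_diff_distrib algebra_simps)
    from indep[OF this] show "x = y" by (simp add: vec_eq_iff forall_2)
  qed
  have "v \<noteq> w" using indep[of 1 "-1"] by auto
  have ind: "vec.independent {v, w}"
  proof (rule vec.independent_insertI)
    show "v \<notin> vec.span {w}"
    proof
      assume "v \<in> vec.span {w}"
      then obtain k where "v = k *s w" by (auto simp: vec.span_singleton)
      then show False using indep[of 1 "-k"] by simp
    qed
    show "vec.independent {w}"
      using indep[of 0 1] by auto
  qed
  have span: "vec.span {v, w} = range (\<lambda>z :: complex ^ 2. z $ 1 *s v + z $ 2 *s w)"
  proof (intro equalityI subsetI)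
    fix x assume "x \<in> vec.span {v, w}"
    then obtain k where "x - k *s v \<in> vec.span {w}" by (auto simp: vec.span_insert)
    then obtain j where "x - k *s v = j *s w" by (auto simp: vec.span_singleton)
    then have "x = (\<lambda>z :: complex ^ 2. z $ 1 *s v + z $ 2 *s w) (vector [k, j])"
      by (simp add: algebra_simps)
    then show "x \<in> range (\<lambda>z :: complex ^ 2. z $ 1 *s v + z $ 2 *s w)" by blast
  next
    fix x assume "x \<in> range (\<lambda>z :: complex ^ 2. z $ 1 *s v + z $ 2 *s w)"
    then show "x \<in> vec.span {v, w}"
      by (auto intro!: vec.span_add vec.span_scale intro: vec.span_base)
  qed
  have "complex_plane (range ?f)"
    unfolding complex_plane_def
  proof (intro exI conjI)
    show "vec.dim (vec.span {v, w}) = 2"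
      using ind \<open>v \<noteq> w\<close> by (simp add: vec.dim_eq_card_independent)
    show "range ?f = (\<lambda>x. p + x) ` vec.span {v, w}"
      unfolding span by (auto simp: image_image add.assoc)
  qed (rule vec.subspace_span)
  moreover have "a \<in> range ?f"
    using a by (intro range_eqI[of _ _ "vector [\<alpha>, \<beta>]"]) simp
  ultimately have "pseudoconvex_in_plane (range ?f) (range ?f \<inter> D)"
    using assms(1) unfolding S_def by blast
  moreover have "plane_coords ?f (range ?f)"
    unfolding plane_coords_def using f inj by (blast intro: inj_on_imp_bij_betw)
  ultimately have "pseudoconvex (?f -` (range ?f \<inter> D))"
    unfolding pseudoconvex_in_plane_def by blast
  moreover have "?f -` (range ?f \<inter> D) = ?f -` D" by auto
  ultimately show ?thesis by simp
qed

text \<open>The continuity principle in the form used below: discs in direction \<open>w\<close> are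
  moved along \<open>v\<close>, from the centre \<open>p + \<sigma> *s v\<close> to
  \<open>p\<close>, within a plane through \<open>a\<close>.\<close>

lemma disc_family_slice:
  fixes D :: "(complex ^ 'n) set"
  assumes "a \<notin> S D" and "a = p + \<alpha> *s v + \<beta> *s w"
    and "\<And>x y. x *s v + y *s w = 0 \<Longrightarrow> x = 0 \<and> y = 0"
    and bd: "\<And>t \<tau>. 0 \<le> t \<Longrightarrow> t \<le> 1 \<Longrightarrow> cmod \<tau> = \<rho> \<Longrightarrow> p + (of_real t * \<sigma>) *s v + \<tau> *s w \<in> D"
    and init: "\<And>\<tau>. cmod \<tau> \<le> \<rho> \<Longrightarrow> p + \<sigma> *s v + \<tau> *s w \<in> D"
    and "\<rho> \<ge> 0"
  shows "p \<in> D"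
proof -
  let ?\<Omega> = "(\<lambda>z :: complex ^ 2. p + z $ 1 *s v + z $ 2 *s w) -` D"
  have "(0 :: complex ^ 2) + 0 *s vector [0, 1] \<in> ?\<Omega>"
  proof (rule pseudoconvex_disc_family[where d = "vector [\<sigma>, 0]"])
    show "pseudoconvex ?\<Omega>" using assms(1-3) by (rule pseudoconvex_slice)
  qed (use assms in auto)
  then show ?thesis by simp
qed


section \<open>Domains containing \<open>G\<close> near the origin\<close>

lemma vector_nth_3_zero: "z $ 3 = 0 \<Longrightarrow> vector [z $ 1, z $ 2, 0] = z" for z :: "complex ^ 3"
  by (simp add: vec_eq_iff forall_3)

lemma norm_vector_scalar_mult: "norm (c *s z) = cmod c * norm z" for z :: "complex ^ 'n"
  by (simp add: norm_vec_def norm_mult L2_set_right_distrib)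

lemma mem_G_polydisc:
  assumes "G \<inter> polydisc \<epsilon> \<subseteq> D" "cmod x < \<epsilon>" "cmod y < \<epsilon>" "cmod z < \<epsilon>"
    and "2 * Re z + (Im z)\<^sup>2 + (cmod x)\<^sup>2 - (cmod y)\<^sup>2 < 0"
  shows "vector [x, y, z] \<in> D"
proof -
  have "vector [x, y, z] \<in> G \<inter> polydisc \<epsilon>"
    using assms(2-) by (simp add: G_def polydisc_def forall_3)
  then show ?thesis using assms(1) by blast
qed

text \<open>Discs in direction \<open>vector [0, 1, 0]\<close> are pushed from the side where the
  third coordinate is negative to the origin. The gain from that coordinate is linear in the
  displacement, the loss from the first one only quadratic.\<close>

lemma transversal_plane_imp_S:
  fixes D :: "(complex ^ 3) set"
  assumes G: "G \<inter> polydisc \<epsilon> \<subseteq> D" and "0 \<notin> D" "\<epsilon> > 0" "w3 \<noteq> 0"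
    and a: "a = \<alpha> *s vector [w1, 0, w3] + \<beta> *s vector [0, 1, 0]"
  shows "a \<in> S D"
proof (rule ccontr)
  assume "a \<notin> S D"
  define B where "B = 1 + cmod w1 + cmod w3"
  \<comment> \<open>With this step size, \<open>s\<close> times each of the products of
    \<open>cmod w1\<close> and \<open>cmod w3\<close> needed below is less than 1, to absorb the
    quadratic term, and less than \<open>\<epsilon>\<close>, to stay in the polydisc.\<close>
  define s where "s = min 1 \<epsilon> / B\<^sup>2"
  have B1: "B > 0" "cmod w1 < B" "cmod w3 < B"
    using norm_ge_zero[of w1] norm_ge_zero[of w3] unfolding B_def by linarith+
  then have B: "B > 0" "(cmod w1)\<^sup>2 < B\<^sup>2" "(cmod w3)\<^sup>2 < B\<^sup>2"
    by (auto intro!: power_strict_mono)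
  have B2: "cmod w3 * cmod w1 < B\<^sup>2"
    unfolding power2_eq_square using B1 by (intro mult_strict_mono') auto
  have s: "s > 0" using \<open>\<epsilon> > 0\<close> B by (simp add: s_def)
  have small: "s * x < 1 \<and> s * x < \<epsilon>" if "0 \<le> x" "x < B\<^sup>2" for x
  proof -
    have "s * x < s * B\<^sup>2" using s that by simp
    also have "s * B\<^sup>2 = min 1 \<epsilon>" using B by (simp add: s_def)
    finally show ?thesis by simp
  qed
  \<comment> \<open>The conjugate makes the third coordinate real and negative, so its imaginary
    part contributes nothing.\<close>
  define \<sigma> where "\<sigma> = - of_real s * cnj w3"
  have ng: "- of_real s * (cnj w3 * w3) = - of_real (s * (cmod w3)\<^sup>2)"
    by (simp only: of_real_mult complex_norm_square) (simp add: mult_ac)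
  \<comment> \<open>One claim covers the initial disc and all boundary circles; among the parameters
    it omits only the pair giving the origin.\<close>
  have inD: "0 + (of_real t * \<sigma>) *s vector [w1, 0, w3] + \<tau> *s vector [0, 1, 0] \<in> D"
    if t: "0 \<le> t" "t \<le> 1" and \<tau>: "cmod \<tau> \<le> \<epsilon> / 2" "t > 0 \<or> \<tau> \<noteq> 0" for t \<tau>
  proof -
    have z: "of_real t * \<sigma> * w3 = of_real (- (t * (s * (cmod w3)\<^sup>2)))"
      using arg_cong[OF ng, of "\<lambda>x. of_real t * x"]
      by (simp only: \<sigma>_def of_real_mult of_real_minus)
        (simp only: mult_ac mult_minus_right mult_minus_left)
    have x: "cmod (of_real t * \<sigma> * w1) = t * (s * (cmod w3 * cmod w1))"
      using t s by (simp add: \<sigma>_def norm_mult mult_ac)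
    have le: "t * y < \<epsilon>" if "0 \<le> y" "y < \<epsilon>" for y
      using t that by (meson le_less_trans mult_left_le_one_le)
    have "vector [of_real t * \<sigma> * w1, \<tau>, of_real t * \<sigma> * w3] \<in> D"
    proof (rule mem_G_polydisc[OF G])
      show "cmod (of_real t * \<sigma> * w1) < \<epsilon>"
        unfolding x using small[OF _ B2] s by (intro le) auto
      show "cmod \<tau> < \<epsilon>" using \<tau> \<open>\<epsilon> > 0\<close> by simp
      show "cmod (of_real t * \<sigma> * w3) < \<epsilon>"
        unfolding z norm_of_real using small[OF _ B(3)] s t by (simp add: le)
      define k where "k = t * (s * (cmod w3)\<^sup>2)"
      have k: "k \<ge> 0" "t > 0 \<Longrightarrow> k > 0" using t s \<open>w3 \<noteq> 0\<close> by (auto simp: k_def)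
      have "t * (s * (cmod w1)\<^sup>2) \<le> 1 * 1"
        using small[OF _ B(2)] t s by (intro mult_mono) auto
      then have "k * (t * (s * (cmod w1)\<^sup>2)) \<le> k * 1"
        using k by (intro mult_left_mono) auto
      moreover have "(t * (s * (cmod w3 * cmod w1)))\<^sup>2 = k * (t * (s * (cmod w1)\<^sup>2))"
        by (simp add: k_def power2_eq_square mult_ac)
      moreover have "k + (cmod \<tau>)\<^sup>2 > 0"
        using \<tau>(2) k by (auto simp: add_pos_nonneg add_nonneg_pos)
      ultimately show "2 * Re (of_real t * \<sigma> * w3) + (Im (of_real t * \<sigma> * w3))\<^sup>2
          + (cmod (of_real t * \<sigma> * w1))\<^sup>2 - (cmod \<tau>)\<^sup>2 < 0"
        unfolding z x k_def[symmetric] by simp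
    qed
    moreover have "0 + (of_real t * \<sigma>) *s vector [w1, 0, w3] + \<tau> *s vector [0, 1, 0]
        = (vector [of_real t * \<sigma> * w1, \<tau>, of_real t * \<sigma> * w3] :: complex ^ 3)"
      by (simp add: vec_eq_iff forall_3)
    ultimately show ?thesis by simp
  qed
  have "0 \<in> D"
  proof (rule disc_family_slice[OF \<open>a \<notin> S D\<close>])
    show "a = 0 + \<alpha> *s vector [w1, 0, w3] + \<beta> *s vector [0, 1, 0]" using a by simp
    show "x = 0 \<and> y = 0" if "x *s vector [w1, 0, w3] + y *s vector [0, 1, 0] = (0 :: complex ^ 3)" for x y
      using that \<open>w3 \<noteq> 0\<close> by (simp add: vec_eq_iff forall_3)
    show "0 + \<sigma> *s vector [w1, 0, w3] + \<tau> *s vector [0, 1, 0] \<in> D"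
      if "cmod \<tau> \<le> \<epsilon> / 2" for \<tau> using inD[of 1 \<tau>] that by simp
    show "0 + (of_real t * \<sigma>) *s vector [w1, 0, w3] + \<tau> *s vector [0, 1, 0] \<in> D"
      if "0 \<le> t" "t \<le> 1" "cmod \<tau> = \<epsilon> / 2" for t \<tau> using inD[of t \<tau>] that \<open>\<epsilon> > 0\<close> by auto
  qed (use \<open>\<epsilon> > 0\<close> in auto)
  then show False using \<open>0 \<notin> D\<close> by simp
qed

text \<open>If \<open>a $ 3\<close> is nonzero, \<open>a\<close> lies in the transversal plane with
  \<open>w1 = a $ 1\<close> and \<open>w3 = a $ 3\<close>; a multiple of
  \<open>vector [0, 1, 0]\<close> lies in every transversal plane.\<close>

lemma not_in_S_imp_tangent:
  fixes D :: "(complex ^ 3) set"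
  assumes "G \<inter> polydisc \<epsilon> \<subseteq> D" "0 \<notin> D" "\<epsilon> > 0" "a \<notin> S D"
  shows "a $ 3 = 0" "a $ 1 \<noteq> 0"
proof -
  have tr: "\<And>w1 w3 \<alpha> \<beta>. w3 \<noteq> 0 \<Longrightarrow> a \<noteq> \<alpha> *s vector [w1, 0, w3] + \<beta> *s vector [0, 1, 0]"
    using transversal_plane_imp_S[OF assms(1-3)] assms(4) by blast
  show a3: "a $ 3 = 0"
    using tr[of "a $ 3" 1 "a $ 1" "a $ 2"] by (auto simp: vec_eq_iff forall_3)
  show "a $ 1 \<noteq> 0"
    using tr[of 1 0 0 "a $ 2"] a3 by (auto simp: vec_eq_iff forall_3)
qed

text \<open>The discs are moved along the line from \<open>a\<close> through \<open>q = (q1, q2, 0)\<close>. That line meets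
  \<open>{z1 = 0}\<close> in \<open>(0, d, 0)\<close>, where \<open>d \<noteq> 0\<close> because \<open>q \<notin> \<complex> a\<close>; the slope \<open>cnj d / 2\<close> of the discs in
  the third coordinate places the disc centred there inside \<open>G\<close>.\<close>

lemma complement_line_subset:
  fixes D :: "(complex ^ 3) set"
  assumes G: "G \<inter> polydisc \<epsilon> \<subseteq> D" and "\<epsilon> > 0" "a \<notin> S D" and a: "a $ 3 = 0" "a $ 1 \<noteq> 0"
  obtains \<eta> where "\<eta> > 0"
    "\<And>q1 q2. cmod q1 < \<eta> \<Longrightarrow> cmod q2 < \<eta> \<Longrightarrow> a $ 1 * q2 \<noteq> a $ 2 * q1 \<Longrightarrow> vector [q1, q2, 0] \<in> D"
proof -
  define \<rho> where "\<rho> = min 1 \<epsilon> / 2"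
  have \<rho>: "0 < \<rho>" "2 * \<rho> \<le> 1" "2 * \<rho> \<le> \<epsilon>" using \<open>\<epsilon> > 0\<close> by (auto simp: \<rho>_def)
  define A where "A = cmod (a $ 1)"
  define B where "B = cmod (a $ 2)"
  have A: "A > 0" "B \<ge> 0" using a by (auto simp: A_def B_def)
  \<comment> \<open>The three bounds keep \<open>q\<close> small against the disc radius
    \<open>\<rho>\<close>, keep \<open>q1\<close> at distance at least \<open>A / 2\<close> from
    \<open>a $ 1\<close>, and yield \<open>cmod d \<le> \<rho> / 8\<close>.\<close>
  define \<eta> where "\<eta> = min (min (\<rho> / 8) (A / 2)) (\<rho> * A / (16 * (A + B)))"
  have \<eta>: "\<eta> > 0" "\<eta> \<le> \<rho> / 8" "\<eta> \<le> A / 2" "\<eta> \<le> \<rho> * A / (16 * (A + B))"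
    unfolding \<eta>_def using A \<rho> by (auto simp del: distrib_left_numeral)
  have \<eta>': "\<eta> * (A + B) \<le> \<rho> / 8 * (A / 2)"
    using \<eta>(4) A by (simp add: field_simps)
  have "vector [q1, q2, 0] \<in> D"
    if q: "cmod q1 < \<eta>" "cmod q2 < \<eta>" "a $ 1 * q2 \<noteq> a $ 2 * q1" for q1 q2
  proof -
    have A1: "cmod (q1 - a $ 1) \<ge> A / 2"
      using norm_triangle_ineq2[of "a $ 1" q1] q(1) \<eta>(3)
      by (simp add: A_def norm_minus_commute)
    then have nz: "q1 - a $ 1 \<noteq> 0" using A by auto
    \<comment> \<open>The parameter at which the line from \<open>q\<close> through \<open>a\<close>
      has first coordinate 0; \<open>d\<close> is its second coordinate there.\<close>
    define \<sigma> where "\<sigma> = q1 / (q1 - a $ 1)"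
    define d where "d = q2 + \<sigma> * (a $ 2 - q2)"
    have d_eq: "d = (q1 * a $ 2 - a $ 1 * q2) / (q1 - a $ 1)"
      using nz by (simp add: d_def \<sigma>_def field_simps)
    have d0: "d \<noteq> 0" using nz q(3) by (simp add: d_eq mult.commute)
    have "cmod (q1 * a $ 2 - a $ 1 * q2) \<le> cmod q1 * B + A * cmod q2"
      unfolding A_def B_def norm_mult[symmetric] by (rule norm_triangle_ineq4)
    also have "\<dots> \<le> \<eta> * B + A * \<eta>" using q A \<eta>(1) by (intro add_mono mult_mono) auto
    also have "\<dots> \<le> \<rho> / 8 * (A / 2)" using \<eta>' by (simp add: algebra_simps)
    also have "\<dots> \<le> \<rho> / 8 * cmod (q1 - a $ 1)" using A1 \<rho> by (intro mult_left_mono) auto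
    finally have d: "cmod d \<le> \<rho> / 8"
      using nz by (simp add: d_eq norm_divide field_simps)
    define m where "m = cnj d / 2"
    have m: "cmod m = cmod d / 2" by (simp add: m_def norm_divide)
    have z3: "cmod (m * \<tau>) < \<epsilon>" if "cmod \<tau> \<le> \<rho>" for \<tau>
    proof -
      have "cmod (m * \<tau>) \<le> \<rho> / 16 * \<rho>"
        unfolding norm_mult m using d that \<rho> by (intro mult_mono) auto
      also have "\<dots> \<le> \<rho> / 16 * 1" using \<rho> by (intro mult_left_mono) auto
      finally show ?thesis using \<rho> by simp
    qed
    have pt: "vector [q1, q2, 0] + s *s (a - vector [q1, q2, 0]) + \<tau> *s vector [0, 1, m]
        = vector [q1 + s * (a $ 1 - q1), q2 + s * (a $ 2 - q2) + \<tau>, m * \<tau>]" for s \<tau>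
      by (simp add: vec_eq_iff forall_3 a algebra_simps)
    show ?thesis
    proof (rule disc_family_slice[OF \<open>a \<notin> S D\<close>])
      show "a = vector [q1, q2, 0] + 1 *s (a - vector [q1, q2, 0]) + 0 *s vector [0, 1, m]"
        by simp
      show "x = 0 \<and> y = 0"
        if "x *s (a - vector [q1, q2, 0]) + y *s vector [0, 1, m] = 0" for x y
        using that nz by (auto simp: vec_eq_iff forall_3)
      show "\<rho> \<ge> 0" using \<rho> by simp
    next
      fix \<tau> assume \<tau>: "cmod \<tau> \<le> \<rho>"
      have c1: "q1 + \<sigma> * (a $ 1 - q1) = 0" using nz by (simp add: \<sigma>_def field_simps)
      define y where "y = cmod (d + \<tau>)"
      define r where "r = cmod d"
      have y: "y \<ge> 0" "r > 0" "r \<le> 1" using d0 d \<rho> by (auto simp: y_def r_def)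
      \<comment> \<open>Expressed through \<open>d + \<tau>\<close>, the defining function of
        \<open>G\<close> is bounded by a negative definite quadratic form in \<open>r\<close> and
        \<open>y\<close>, and \<open>r > 0\<close>.\<close>
      have mt: "m * \<tau> = (cnj d * (d + \<tau>) - of_real (r\<^sup>2)) / 2"
        unfolding r_def complex_norm_square by (simp add: m_def algebra_simps)
      have cd: "cmod (cnj d * (d + \<tau>)) = r * y" by (simp add: norm_mult r_def y_def)
      have re: "2 * Re (m * \<tau>) \<le> r * y - r\<^sup>2"
        unfolding mt using complex_Re_le_cmod[of "cnj d * (d + \<tau>)"] cd by (simp del: of_real_power)
      have "\<bar>Im (m * \<tau>)\<bar> \<le> r * y / 2"
        unfolding mt using abs_Im_le_cmod[of "cnj d * (d + \<tau>)"] cd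
        by (simp del: of_real_power)
      also have "\<dots> \<le> y / 2" using y mult_right_mono[of r 1 y] by simp
      finally have im: "(Im (m * \<tau>))\<^sup>2 \<le> (y / 2)\<^sup>2"
        by (simp add: abs_le_square_iff[symmetric] y)
      have "r * y - r\<^sup>2 + (y / 2)\<^sup>2 - y\<^sup>2 = - (2 / 3 * r\<^sup>2 + 3 / 4 * (y - 2 / 3 * r)\<^sup>2)"
        by (simp add: power2_eq_square field_simps)
      also have "\<dots> < 0"
        using zero_less_power[OF y(2), of 2] zero_le_power2[of "y - 2 / 3 * r"] by linarith
      finally have neg: "r * y - r\<^sup>2 + (y / 2)\<^sup>2 - y\<^sup>2 < 0" .
      have "vector [0, d + \<tau>, m * \<tau>] \<in> D"
      proof (rule mem_G_polydisc[OF G])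
        show "cmod (d + \<tau>) < \<epsilon>" using norm_triangle_ineq[of d \<tau>] d \<tau> \<rho> by linarith
        show "2 * Re (m * \<tau>) + (Im (m * \<tau>))\<^sup>2 + (cmod 0)\<^sup>2 - (cmod (d + \<tau>))\<^sup>2 < 0"
          using re im neg unfolding y_def[symmetric] by simp
      qed (use z3[OF \<tau>] \<open>\<epsilon> > 0\<close> in auto)
      then show "vector [q1, q2, 0] + \<sigma> *s (a - vector [q1, q2, 0]) + \<tau> *s vector [0, 1, m] \<in> D"
        unfolding pt c1 d_def by simp
    next
      fix t :: real and \<tau> assume t: "0 \<le> t" "t \<le> 1" and \<tau>: "cmod \<tau> = \<rho>"
      \<comment> \<open>The centre moves on the segment from \<open>(q1, q2)\<close> to
        \<open>(0, d)\<close>, so both coordinates stay within \<open>\<rho> / 8\<close>. On the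
        circle of radius \<open>\<rho>\<close> the second coordinate then dominates all other
        terms.\<close>
      define x where "x = q1 + of_real t * \<sigma> * (a $ 1 - q1)"
      define c where "c = q2 + of_real t * \<sigma> * (a $ 2 - q2)"
      have "x = of_real (1 - t) * q1"
        using nz by (simp add: x_def \<sigma>_def field_simps)
      then have "cmod x = (1 - t) * cmod q1" using t by (simp only: norm_mult norm_of_real abs_of_nonneg diff_ge_0_iff_ge)
      also have "\<dots> \<le> 1 * (\<rho> / 8)" using t q \<eta> by (intro mult_mono) auto
      finally have x: "cmod x \<le> \<rho> / 8" by simp
      have "c = of_real (1 - t) * q2 + of_real t * d"
        by (simp add: c_def d_def algebra_simps)
      then have "cmod c \<le> (1 - t) * cmod q2 + t * cmod d"
        using norm_triangle_ineq[of "of_real (1 - t) * q2" "of_real t * d"] t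
        by (simp only: norm_mult norm_of_real abs_of_nonneg diff_ge_0_iff_ge)
      also have "\<dots> \<le> (1 - t) * (\<rho> / 8) + t * (\<rho> / 8)"
        using t q \<eta> d by (intro add_mono mult_left_mono) auto
      also have "\<dots> = \<rho> / 8" by (simp add: field_simps)
      finally have c: "cmod c \<le> \<rho> / 8" .
      have low: "cmod (c + \<tau>) \<ge> 7 / 8 * \<rho>"
        using norm_triangle_ineq2[of \<tau> "- c"] c \<tau> by (simp add: add.commute)
      have mt: "cmod (m * \<tau>) \<le> \<rho> / 16 * \<rho>"
        unfolding norm_mult m using d \<tau> \<rho> by (intro mult_mono) auto
      have mt': "cmod (m * \<tau>) \<le> \<rho> / 16"
        using mt mult_left_mono[of \<rho> 1 "\<rho> / 16"] \<rho> by linarith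
      have "vector [x, c + \<tau>, m * \<tau>] \<in> D"
      proof (rule mem_G_polydisc[OF G])
        show "cmod x < \<epsilon>" using x \<rho> by linarith
        show "cmod (c + \<tau>) < \<epsilon>" using norm_triangle_ineq[of c \<tau>] c \<tau> \<rho> by linarith
        have "2 * Re (m * \<tau>) \<le> \<rho>\<^sup>2 / 8"
          using complex_Re_le_cmod[of "m * \<tau>"] mt by (simp add: power2_eq_square)
        moreover have "(Im (m * \<tau>))\<^sup>2 \<le> (\<rho> / 16)\<^sup>2"
          using abs_Im_le_cmod[of "m * \<tau>"] mt' \<rho> by (simp add: abs_le_square_iff[symmetric])
        moreover have "(cmod x)\<^sup>2 \<le> (\<rho> / 8)\<^sup>2" using x by (intro power_mono) auto
        moreover have "(7 / 8 * \<rho>)\<^sup>2 \<le> (cmod (c + \<tau>))\<^sup>2" using low \<rho> by (intro power_mono) auto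
        moreover have "\<rho>\<^sup>2 > 0" using \<rho> by simp
        ultimately show "2 * Re (m * \<tau>) + (Im (m * \<tau>))\<^sup>2 + (cmod x)\<^sup>2 - (cmod (c + \<tau>))\<^sup>2 < 0"
          by (simp only: power_mult_distrib power_divide power2_eq_square[of "numeral _"])
      qed (use z3 \<tau> in auto)
      then show "vector [q1, q2, 0] + (of_real t * \<sigma>) *s (a - vector [q1, q2, 0])
          + \<tau> *s vector [0, 1, m] \<in> D"
        unfolding pt x_def c_def by simp
    qed
  qed
  then show ?thesis using \<eta>(1) that by blast
qed

text \<open>A point of the line in \<open>D\<close> would complete a disc \<open>z $ 1 = x\<close>
  in the plane \<open>z $ 3 = 0\<close>, whose other points lie in \<open>D\<close> by
  \<open>complement_line_subset\<close>. Shrinking \<open>x\<close> to 0 within this plane, which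
  contains \<open>a\<close>, would give \<open>0 \<in> D\<close>.\<close>

lemma line_disjoint:
  fixes D :: "(complex ^ 3) set"
  assumes G: "G \<inter> polydisc \<epsilon> \<subseteq> D" and "0 \<notin> D" "\<epsilon> > 0" "a \<notin> S D"
    and a: "a $ 3 = 0" "a $ 1 \<noteq> 0"
  obtains \<eta> where "\<eta> > 0" "\<And>c. cmod (c * a $ 1) < \<eta> \<Longrightarrow> c *s a \<notin> D"
proof -
  obtain \<eta> where \<eta>: "\<eta> > 0" and compl:
    "\<And>q1 q2. cmod q1 < \<eta> \<Longrightarrow> cmod q2 < \<eta> \<Longrightarrow> a $ 1 * q2 \<noteq> a $ 2 * q1 \<Longrightarrow> vector [q1, q2, 0] \<in> D"
    using complement_line_subset[OF G \<open>\<epsilon> > 0\<close> \<open>a \<notin> S D\<close> a] by blast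
  define \<rho> where "\<rho> = min \<eta> \<epsilon> / 2"
  have \<rho>: "\<rho> > 0" "\<rho> < \<eta>" "\<rho> < \<epsilon>" using \<eta> \<open>\<epsilon> > 0\<close> by (auto simp: \<rho>_def)
  have "c *s a \<notin> D" if c: "cmod (c * a $ 1) < \<rho>" for c
  proof
    assume ca: "c *s a \<in> D"
    define x where "x = c * a $ 1"
    have disc: "vector [x, \<tau>, 0] \<in> D" if "cmod \<tau> \<le> \<rho>" for \<tau>
    \<comment> \<open>Since \<open>a $ 1\<close> is nonzero, the disc meets the line in at most the
      point \<open>c *s a\<close>.\<close>
    proof (cases "a $ 1 * \<tau> = a $ 2 * x")
      case True
      then have "c *s a = vector [x, \<tau>, 0]"
        using a by (simp add: x_def vec_eq_iff forall_3 mult_ac)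
      then show ?thesis using ca by simp
    qed (use compl c that \<rho> in \<open>simp add: x_def\<close>)
    have pt: "0 + s *s vector [1, 0, 0] + \<tau> *s vector [0, 1, 0]
        = (vector [s, \<tau>, 0] :: complex ^ 3)" for s \<tau>
      by (simp add: vec_eq_iff forall_3)
    have "0 \<in> D"
    proof (rule disc_family_slice[OF \<open>a \<notin> S D\<close>, of 0 "a $ 1" "vector [1, 0, 0]" "a $ 2" "vector [0, 1, 0]" \<rho> x])
      fix t :: real and \<tau> assume t: "0 \<le> t" "t \<le> 1" and \<tau>: "cmod \<tau> = \<rho>"
      have "t * cmod x \<le> 1 * cmod x" using t by (intro mult_right_mono) auto
      then have lt: "cmod (of_real t * x) < \<rho>"
        using c t by (simp add: norm_mult x_def)
      \<comment> \<open>With third coordinate 0, membership in \<open>G\<close> only asks that the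
        first coordinate be smaller in modulus than the second.\<close>
      then have "vector [of_real t * x, \<tau>, 0] \<in> D"
        using \<tau> \<rho> by (intro mem_G_polydisc[OF G]) (auto intro!: power_strict_mono)
      then show "0 + (of_real t * x) *s vector [1, 0, 0] + \<tau> *s vector [0, 1, 0] \<in> D"
        unfolding pt .
    next
      show "0 + x *s vector [1, 0, 0] + \<tau> *s vector [0, 1, 0] \<in> D" if "cmod \<tau> \<le> \<rho>" for \<tau>
        unfolding pt using disc that .
    qed (use a \<rho> in \<open>auto simp: vec_eq_iff forall_3\<close>)
    then show False using \<open>0 \<notin> D\<close> by simp
  qed
  then show ?thesis using \<rho>(1) that by blast
qed

section \<open>The exceptional line\<close>

theorem proposition1:
  fixes D :: "(complex ^ 3) set" and \<epsilon> :: real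
  assumes "open D"
    and "0 \<in> frontier D"
    and "\<epsilon> > 0"
    and "G \<inter> polydisc \<epsilon> \<subseteq> D"
    and "S D \<noteq> UNIV"
  shows "\<exists>l. vec.subspace l \<and> vec.dim l = 1 \<and> l \<subseteq> {z. z $ 3 = 0} \<and>
           subset_near_0 ({z. z $ 3 = 0} - l) D \<and>
           subset_near_0 l (frontier D) \<and>
           UNIV - l \<subseteq> S D"
proof -
  have D0: "0 \<notin> D" using assms(1,2) by (simp add: frontier_def interior_open)
  note tangent = not_in_S_imp_tangent[OF assms(4) D0 assms(3)]
  obtain a where aS: "a \<notin> S D" using assms(5) by blast
  note a = tangent[OF aS]
  define l where "l = vec.span {a}"
  have l: "z \<in> l \<longleftrightarrow> (\<exists>c. z = c *s a)" for z
    by (auto simp: l_def vec.span_singleton)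
  have l': "z \<in> l \<longleftrightarrow> z $ 3 = 0 \<and> a $ 1 * z $ 2 = a $ 2 * z $ 1" for z
  proof
    assume "z $ 3 = 0 \<and> a $ 1 * z $ 2 = a $ 2 * z $ 1"
    then have "z = (z $ 1 / a $ 1) *s a" using a by (simp add: vec_eq_iff forall_3 field_simps)
    then show "z \<in> l" unfolding l by blast
  qed (auto simp: l a)
  obtain \<eta> where \<eta>: "\<eta> > 0" and compl:
    "\<And>q1 q2. cmod q1 < \<eta> \<Longrightarrow> cmod q2 < \<eta> \<Longrightarrow> a $ 1 * q2 \<noteq> a $ 2 * q1 \<Longrightarrow> vector [q1, q2, 0] \<in> D"
    using complement_line_subset[OF assms(4,3) aS a] by blast
  obtain \<theta> where \<theta>: "\<theta> > 0" and disj: "\<And>c. cmod (c * a $ 1) < \<theta> \<Longrightarrow> c *s a \<notin> D"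
    using line_disjoint[OF assms(4) D0 assms(3) aS a] by blast
  have compl': "z \<in> D" if "z $ 3 = 0" "z \<notin> l" "norm z < \<eta>" for z
  proof -
    have "cmod (z $ i) < \<eta>" for i
      using Finite_Cartesian_Product.norm_nth_le[of z i] that(3) by linarith
    then have "vector [z $ 1, z $ 2, 0] \<in> D" using that l' by (intro compl) auto
    then show ?thesis using vector_nth_3_zero[of z] that(1) by simp
  qed
  have disj': "z \<notin> D" if z: "z \<in> l" "norm z < \<theta>" for z
  proof -
    obtain c where c: "z = c *s a" using z(1) unfolding l by blast
    have "cmod (z $ 1) < \<theta>" using Finite_Cartesian_Product.norm_nth_le[of z 1] z(2) by linarith
    then show ?thesis using disj[of c] by (simp add: c)
  qed
  have front: "z \<in> frontier D" if z: "z \<in> l" "norm z < min \<eta> \<theta>" for z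
  proof -
    have "z \<in> closure D"
      unfolding closure_approachable
    proof (intro allI impI)
      fix e :: real assume "e > 0"
      define s where "s = min e (\<eta> - norm z) / 2"
      have s: "0 < s" "s < e" "s < \<eta> - norm z"
        using \<open>e > 0\<close> z(2) by (auto simp: s_def)
      \<comment> \<open>A shift in the second coordinate leaves \<open>l\<close> because
        \<open>a $ 1\<close> is nonzero, so points of \<open>D\<close> accumulate at
        \<open>z\<close>.\<close>
      define w :: "complex ^ 3" where "w = vector [0, of_real s, 0]"
      have w: "norm w = s" using s by (simp add: w_def norm_vec_def L2_set_def sum_3)
      have "z + w \<in> D"
      proof (rule compl')
        show "(z + w) $ 3 = 0" using z(1) by (simp add: l' w_def)
        show "z + w \<notin> l" using z(1) s a by (simp add: l' w_def algebra_simps)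
        show "norm (z + w) < \<eta>" using norm_triangle_ineq[of z w] w s by linarith
      qed
      then show "\<exists>y\<in>D. dist y z < e" using w s by (intro bexI[of _ "z + w"]) (simp_all add: dist_norm)
    qed
    then show ?thesis using disj' z assms(1) by (simp add: frontier_def interior_open)
  qed
  have "b \<in> l" if bS: "b \<notin> S D" for b
  proof (rule ccontr)
    assume "b \<notin> l"
    note b = tangent[OF bS]
    obtain \<kappa> where \<kappa>: "\<kappa> > 0" and disjb: "\<And>c. cmod (c * b $ 1) < \<kappa> \<Longrightarrow> c *s b \<notin> D"
      using line_disjoint[OF assms(4) D0 assms(3) bS b] by blast
    \<comment> \<open>The scaled point is close enough to 0 for two contradictory facts: off
      \<open>l\<close> it belongs to \<open>D\<close>, and on the line through \<open>b\<close> it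
      does not.\<close>
    define k where "k = min \<kappa> \<eta> / (1 + norm b)"
    have nb: "1 + norm b > 0" by (simp add: add_pos_nonneg)
    have k: "k > 0" using \<kappa> \<eta> nb by (simp add: k_def)
    have "k * norm b < k * (1 + norm b)" using k by simp
    also have "\<dots> = min \<kappa> \<eta>" using nb by (simp add: k_def)
    finally have kb: "k * norm b < min \<kappa> \<eta>" .
    have bi: "norm (of_real k *s b) = k * norm b"
      using k by (simp add: norm_vector_scalar_mult)
    have "of_real k *s b \<in> D"
    proof (rule compl')
      show "of_real k *s b \<notin> l" using \<open>b \<notin> l\<close> k by (simp add: l' algebra_simps)
    qed (use b kb bi in auto)
    moreover have "cmod (of_real k * b $ 1) < \<kappa>"
      using Finite_Cartesian_Product.norm_nth_le[of "of_real k *s b" 1] bi kb by simp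
    ultimately show False using disjb by blast
  qed
  then have "UNIV - l \<subseteq> S D" by blast
  moreover have "vec.subspace l" unfolding l_def by (rule vec.subspace_span)
  moreover have "a \<noteq> 0" using a by auto
  then have "vec.dim l = 1"
    unfolding l_def by (simp add: vec.dim_span_eq_card_independent)
  moreover have "l \<subseteq> {z. z $ 3 = 0}" using l' by blast
  moreover have "subset_near_0 ({z. z $ 3 = 0} - l) D"
    unfolding subset_near_0_def using compl' \<eta>
    by (intro exI[of _ "ball 0 \<eta>"]) auto
  moreover have "subset_near_0 l (frontier D)"
    unfolding subset_near_0_def using front \<eta> \<theta>
    by (intro exI[of _ "ball 0 (min \<eta> \<theta>)"]) auto
  ultimately show ?thesis by blast
qed

end
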